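(* Let $l$ be a complete lattice which is a de Morgan algebra with residual implication. Let $TS=(S,Act,\to,I,AP,L)$ be an mv-transition system without terminal states, and let $P:(2^{AP})^{\omega}\to l$ be such that $L_\omega(\mathcal A)=\neg P$ for some deterministic $l$-valued Büchi automaton $\mathcal A=(Q,2^{AP},\delta,q_0,F)$. Then $TS\models P$ if and only if $TS\otimes\mathcal A\models\mathrm{pers}(\varphi)$, where $\varphi=\bigvee_{q\in Q}(\neg F(q)\wedge q)$ is an mv-proposition formula over the atomic propositions $Q$.
   Context: $l$: complete distributive lattice with $x\wedge\bigvee a_i=\bigvee(x\wedge a_i)$, order-reversing involution $\neg$ (with $(\neg P)(\sigma)=\neg P(\sigma)$), implication $a\to b=\bigvee\{c:a\wedge c\le b\}$. An mv-TS is $(S,Act,\to,I,AP,L)$ with finite $S,Act,AP$, transition map $\eta:S\times Act\times S\to l$, $I:S\to l$, $L:S\to2^{AP}$; no terminal states means every $s$ has $\alpha,s'$ with $\eta(s,\alpha,s')>0$. For $\rho=s_0\alpha_1s_1\cdots$, $v(\rho)=I(s_0)\wedge\bigwedge_i\eta(s_i,\alpha_{i+1},s_{i+1})$; $\mathrm{Traces}(TS)(\sigma)=\bigvee\{v(\rho):L(s_0)L(s_1)\cdots=\sigma\}$; $TS\models P$ iff $\mathrm{Traces}(TS)(\sigma)\le P(\sigma)$ for all $\sigma$. A deterministic $l$-VBA $(Q,\Sigma,\delta,q_0,F)$ has finite $Q$, $\delta:Q\times\Sigma\to Q$, $q_0\in Q$, $F:Q\to l$; for $w=\sigma_1\sigma_2\cdots$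 with run $q_{j}=\delta(q_{j-1},\sigma_j)$, $L_\omega(\mathcal A)(w)=\bigvee\{\bigwedge_{j\in J}F(q_j):J\subseteq\mathbb N\text{ infinite}\}$. The product $TS\otimes\mathcal A=(S\times Q,Act,\to',I',Q,L')$: $\eta'((s,q),\alpha,(t,p))=\eta(s,\alpha,t)$ if $\delta(q,L(t))=p$, else $0$; $I'(s,q)=I(s)$ if $\delta(q_0,L(s))=q$, else $0$; $L'(s,q)=\{q\}$. mv-proposition formulas over $AP'$: $\psi::=A\mid r\mid\psi\vee\psi\mid\psi\to\psi\mid\neg\psi$ ($r\in l$, $\wedge$ defined by de Morgan), $\psi(\Phi)$ evaluates atoms in $\Phi$ to $1$, others to $0$. $\mathrm{pers}(\psi)(A_0A_1\cdots)=\bigvee_{i\ge0}\bigwedge_{j\ge i}\psi(A_j)$. *)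

theory Defs
  imports "HOL-Library.Omega_Words_Fun"
begin

section \<open>Truth values\<close>

text \<open>
  The library class \<open>complete_distrib_lattice\<close> demands complete distributivity, which is too
  strong here: only the distribution of binary meets over arbitrary joins is required, which is
  exactly what makes the residual implication right adjoint to the meet. The involution is
  written as unary minus, so that the pointwise instance of \<open>uminus\<close> on functions is
  the complement of an mv-property.
\<close>

class residuated_de_morgan = complete_lattice + uminus +
  assumes inf_Sup_distrib: "inf x (Sup A) = Sup (inf x ` A)"
    and uminus_uminus: "- (- x) = x"
    and uminus_antimono: "x \<le> y \<Longrightarrow> - y \<le> - x"

definition residual :: "'l::complete_lattice \<Rightarrow> 'l \<Rightarrow> 'l" where
  "residual a b = Sup {c. inf a c \<le> b}"


section \<open>Multi-valued transition systems\<close>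

definition omega_words :: "'a set \<Rightarrow> 'a word set" where
  "omega_words \<Sigma> = {w. \<forall>i. w i \<in> \<Sigma>}"

text \<open>
  The functions stored in the records are total; only their values on the carriers matter.
\<close>

record ('s, 'a, 'p, 'l) mvts =
  states :: "'s set"
  actions :: "'a set"
  trans :: "'s \<Rightarrow> 'a \<Rightarrow> 's \<Rightarrow> 'l"
  init :: "'s \<Rightarrow> 'l"
  atoms :: "'p set"
  label :: "'s \<Rightarrow> 'p set"

definition is_mvts :: "('s, 'a, 'p, 'l::complete_lattice) mvts \<Rightarrow> bool" where
  "is_mvts TS \<longleftrightarrow> finite (states TS) \<and> finite (actions TS) \<and> finite (atoms TS) \<and>
     (\<forall>s \<in> states TS. label TS s \<subseteq> atoms TS)"

definition no_terminal_states :: "('s, 'a, 'p, 'l::complete_lattice) mvts \<Rightarrow> bool" where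
  "no_terminal_states TS \<longleftrightarrow>
     (\<forall>s \<in> states TS. \<exists>\<alpha> \<in> actions TS. \<exists>s' \<in> states TS. trans TS s \<alpha> s' > bot)"

text \<open>
  A run \<open>s\<^sub>0 \<alpha>\<^sub>1 s\<^sub>1 \<alpha>\<^sub>2 \<dots>\<close> is the pair of its state sequence and its action sequence, the
  latter being shifted by one: the action at index \<open>i\<close> is \<open>\<alpha>\<^bsub>i+1\<^esub>\<close>. All alternating sequences
  are runs; those that use an impossible transition have value \<open>bot\<close>.
\<close>

definition runs :: "('s, 'a, 'p, 'l::complete_lattice) mvts \<Rightarrow> ('s word \<times> 'a word) set" where
  "runs TS = omega_words (states TS) \<times> omega_words (actions TS)"

definition run_value :: "('s, 'a, 'p, 'l::complete_lattice) mvts \<Rightarrow> 's word \<times> 'a word \<Rightarrow> 'l" where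
  "run_value TS = (\<lambda>(s, \<alpha>). inf (init TS (s 0)) (INF i. trans TS (s i) (\<alpha> i) (s (Suc i))))"

definition traces :: "('s, 'a, 'p, 'l::complete_lattice) mvts \<Rightarrow> 'p set word \<Rightarrow> 'l" where
  "traces TS \<sigma> = Sup {run_value TS \<rho> | \<rho>. \<rho> \<in> runs TS \<and> label TS \<circ> fst \<rho> = \<sigma>}"

definition satisfies ::
  "('s, 'a, 'p, 'l::complete_lattice) mvts \<Rightarrow> ('p set word \<Rightarrow> 'l) \<Rightarrow> bool" where
  "satisfies TS P \<longleftrightarrow> (\<forall>\<sigma> \<in> omega_words (Pow (atoms TS)). traces TS \<sigma> \<le> P \<sigma>)"


section \<open>Deterministic lattice-valued Buechi automata\<close>

record ('q, 'x, 'l) dvba =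
  locations :: "'q set"
  alphabet :: "'x set"
  step :: "'q \<Rightarrow> 'x \<Rightarrow> 'q"
  start :: "'q"
  final :: "'q \<Rightarrow> 'l"

definition is_dvba :: "('q, 'x, 'l::complete_lattice) dvba \<Rightarrow> bool" where
  "is_dvba A \<longleftrightarrow> finite (locations A) \<and> start A \<in> locations A \<and>
     (\<forall>q \<in> locations A. \<forall>x \<in> alphabet A. step A q x \<in> locations A)"

text \<open>The letter at index \<open>j\<close> of the word is \<open>\<sigma>\<^bsub>j+1\<^esub>\<close>, so the step equation is \<open>q\<^bsub>j+1\<^esub> = \<delta>(q\<^sub>j, \<sigma>\<^bsub>j+1\<^esub>)\<close>.\<close>

primrec dvba_run :: "('q, 'x, 'l) dvba \<Rightarrow> 'x word \<Rightarrow> 'q word" where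
  "dvba_run A w 0 = start A"
| "dvba_run A w (Suc j) = step A (dvba_run A w j) (w j)"

definition omega_lang :: "('q, 'x, 'l::complete_lattice) dvba \<Rightarrow> 'x word \<Rightarrow> 'l" where
  "omega_lang A w = Sup {INF j\<in>J. final A (dvba_run A w j) | J. infinite J}"


section \<open>Product\<close>

definition product ::
  "('s, 'a, 'p, 'l::complete_lattice) mvts \<Rightarrow> ('q, 'p set, 'l) dvba \<Rightarrow> ('s \<times> 'q, 'a, 'q, 'l) mvts"
where
  "product TS A =
    \<lparr> states = states TS \<times> locations A,
      actions = actions TS,
      trans = (\<lambda>(s, q) \<alpha> (t, p). if step A q (label TS t) = p then trans TS s \<alpha> t else bot),
      init = (\<lambda>(s, q). if step A (start A) (label TS s) = q then init TS s else bot),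
      atoms = locations A,
      label = (\<lambda>(s, q). {q}) \<rparr>"

lemma is_mvts_product:
  assumes "is_mvts TS" and "is_dvba A"
  shows "is_mvts (product TS A)"
  using assms by (auto simp: is_mvts_def is_dvba_def product_def)


section \<open>Propositional formulas and persistence\<close>

datatype (form_atoms: 'p, 'l) mvform =
    Atom 'p
  | Const 'l
  | Or "('p, 'l) mvform" "('p, 'l) mvform"
  | Imp "('p, 'l) mvform" "('p, 'l) mvform"
  | Neg "('p, 'l) mvform"

definition And :: "('p, 'l) mvform \<Rightarrow> ('p, 'l) mvform \<Rightarrow> ('p, 'l) mvform" where
  "And \<psi> \<chi> = Neg (Or (Neg \<psi>) (Neg \<chi>))"

fun Big_Or :: "('p, 'l::complete_lattice) mvform list \<Rightarrow> ('p, 'l) mvform" where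
  "Big_Or [] = Const bot"
| "Big_Or [\<psi>] = \<psi>"
| "Big_Or (\<psi> # \<chi> # \<psi>s) = Or \<psi> (Big_Or (\<chi> # \<psi>s))"

primrec form_eval :: "('p, 'l::residuated_de_morgan) mvform \<Rightarrow> 'p set \<Rightarrow> 'l" where
  "form_eval (Atom p) \<Phi> = (if p \<in> \<Phi> then top else bot)"
| "form_eval (Const r) \<Phi> = r"
| "form_eval (Or \<psi> \<chi>) \<Phi> = sup (form_eval \<psi> \<Phi>) (form_eval \<chi> \<Phi>)"
| "form_eval (Imp \<psi> \<chi>) \<Phi> = residual (form_eval \<psi> \<Phi>) (form_eval \<chi> \<Phi>)"
| "form_eval (Neg \<psi>) \<Phi> = - form_eval \<psi> \<Phi>"

definition pers :: "('p, 'l::residuated_de_morgan) mvform \<Rightarrow> 'p set word \<Rightarrow> 'l" where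
  "pers \<psi> \<sigma> = (SUP i. INF j\<in>{i..}. form_eval \<psi> (\<sigma> j))"

text \<open>
  A finite disjunction is a formula only once its disjuncts have been listed; \<open>qs\<close> is a list of
  the locations of the automaton.
\<close>

definition nonfinal_form ::
  "('q, 'x, 'l::residuated_de_morgan) dvba \<Rightarrow> 'q list \<Rightarrow> ('q, 'l) mvform" where
  "nonfinal_form A qs = Big_Or (map (\<lambda>q. And (Neg (Const (final A q))) (Atom q)) qs)"

lemma form_atoms_nonfinal_form: "form_atoms (nonfinal_form A qs) = set qs"
  unfolding nonfinal_form_def
  by (induction qs rule: induct_list012) (auto simp: And_def)

end

theory Submission
  imports Defs
begin

text \<open>
  Since the automaton has finitely many locations, its value on a word is the join of \<open>F(q)\<close> over
  the locations \<open>q\<close> visited infinitely often, while \<open>pers(\<phi>)\<close> on the state sequence of the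
  automaton is the meet of \<open>\<not>F(q)\<close> over the same locations; by de Morgan the two are
  complementary. The runs of the product that follow the automaton correspond to the runs of the
  transition system with equal values, and all other runs of the product have value \<open>bot\<close>.
\<close>

section \<open>Truth values\<close>

lemma le_uminus_swap:
  fixes x y :: "'l::residuated_de_morgan"
  assumes "x \<le> - y"
  shows "y \<le> - x"
  using uminus_antimono[OF assms] by (simp add: uminus_uminus)

text \<open>An order-reversing involution is its own adjoint: moving the complement across the
  inequality reduces the second half to bounding each \<open>f x\<close>.\<close>

lemma uminus_SUP:
  fixes f :: "'b \<Rightarrow> 'l::residuated_de_morgan"
  shows "- (SUP x\<in>X. f x) = (INF x\<in>X. - f x)"
proof (rule antisym)
  show "- (SUP x\<in>X. f x) \<le> (INF x\<in>X. - f x)"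
    by (intro INF_greatest uminus_antimono SUP_upper)
  have "(SUP x\<in>X. f x) \<le> - (INF x\<in>X. - f x)"
    by (rule SUP_least, rule le_uminus_swap, rule INF_lower)
  then show "(INF x\<in>X. - f x) \<le> - (SUP x\<in>X. f x)"
    by (rule le_uminus_swap)
qed

lemma uminus_sup_uminus:
  fixes x y :: "'l::residuated_de_morgan"
  shows "- sup (- x) (- y) = inf x y"
  using uminus_SUP[of uminus "{x, y}"] by (simp add: uminus_uminus)

section \<open>Evaluation of formulas\<close>

lemma form_eval_And: "form_eval (And \<psi> \<chi>) \<Phi> = inf (form_eval \<psi> \<Phi>) (form_eval \<chi> \<Phi>)"
  by (simp add: And_def uminus_sup_uminus)

lemma form_eval_Big_Or: "form_eval (Big_Or \<psi>s) \<Phi> = (SUP \<psi>\<in>set \<psi>s. form_eval \<psi> \<Phi>)"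
  by (induction \<psi>s rule: Big_Or.induct) simp_all

text \<open>Exactly one atom is true in \<open>{q}\<close>, so every disjunct except that of
  \<open>q\<close> evaluates to \<open>bot\<close>.\<close>

lemma form_eval_nonfinal_form:
  assumes "q \<in> set qs"
  shows "form_eval (nonfinal_form A qs) {q} = - final A q"
proof -
  have "form_eval (nonfinal_form A qs) {q} =
      (SUP p\<in>set qs. if p = q then - final A q else bot)"
    unfolding nonfinal_form_def form_eval_Big_Or set_map image_image
    by (rule SUP_cong) (auto simp: form_eval_And)
  also have "\<dots> = - final A q"
    using assms by (intro antisym SUP_least) (auto intro: SUP_upper2[of q])
  finally show ?thesis .
qed

section \<open>Locations visited infinitely often\<close>

text \<open>A value in the limit recurs in every tail, which bounds every tail meet from above.
  Since the range is finite, some tail takes only limit values, and its meet attains the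
  bound.\<close>

lemma SUP_INF_eq_INF_limit:
  fixes f :: "'q \<Rightarrow> 'l::complete_lattice"
  assumes "finite (range r)"
  shows "(SUP i. INF j\<in>{i..}. f (r j)) = (INF q\<in>limit r. f q)"
proof (rule antisym)
  show "(SUP i. INF j\<in>{i..}. f (r j)) \<le> (INF q\<in>limit r. f q)"
  proof (intro SUP_least INF_greatest)
    fix i q assume "q \<in> limit r"
    then obtain j where "j \<ge> i" "r j = q"
      by (auto simp: limit_def INFM_nat_le)
    then show "(INF j\<in>{i..}. f (r j)) \<le> f q"
      by (auto intro: INF_lower2)
  qed
  obtain k where k: "limit r = range (suffix k r)"
    using limit_is_suffix[OF assms] by blast
  have "r j \<in> limit r" if "j \<ge> k" for j
    unfolding k using that by (intro image_eqI[of _ _ "j - k"]) auto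
  then have "(INF q\<in>limit r. f q) \<le> (INF j\<in>{k..}. f (r j))"
    by (auto intro: INF_greatest INF_lower)
  then show "(INF q\<in>limit r. f q) \<le> (SUP i. INF j\<in>{i..}. f (r j))"
    by (rule SUP_upper2[OF UNIV_I])
qed

text \<open>By the pigeonhole principle an infinite \<open>J\<close> meets some location infinitely
  often, which bounds its meet by \<open>final A q\<close>. Conversely, all positions of a recurring
  \<open>q\<close> form an admissible \<open>J\<close>.\<close>

lemma omega_lang_eq_SUP_limit:
  assumes "finite (range (dvba_run A w))"
  shows "omega_lang A w = (SUP q\<in>limit (dvba_run A w). final A q)"
  unfolding omega_lang_def
proof (rule antisym[OF Sup_least SUP_least])
  fix x assume "x \<in> {INF j\<in>J. final A (dvba_run A w j) | J. infinite J}"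
  then obtain J where J: "infinite J" "x = (INF j\<in>J. final A (dvba_run A w j))"
    by blast
  obtain q where q: "infinite {j\<in>J. dvba_run A w j = q}"
    using pigeonhole_infinite[OF J(1) finite_subset[OF image_mono[OF subset_UNIV] assms]]
    by blast
  then obtain j where "j \<in> J" "dvba_run A w j = q"
    using not_finite_existsD by blast
  then have "x \<le> final A q"
    unfolding J(2) by (auto intro: INF_lower)
  moreover have "infinite {j. dvba_run A w j = q}"
    using q by (rule contrapos_nn) (auto elim: rev_finite_subset)
  then have "q \<in> limit (dvba_run A w)"
    by (simp add: limit_def frequently_cofinite)
  ultimately show "x \<le> (SUP q\<in>limit (dvba_run A w). final A q)"
    by (rule SUP_upper2[rotated])
next
  fix q assume "q \<in> limit (dvba_run A w)"
  then have inf: "infinite {j. dvba_run A w j = q}"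
    by (simp add: limit_def frequently_cofinite)
  have "final A q \<le> (INF j\<in>{j. dvba_run A w j = q}. final A (dvba_run A w j))"
    by (rule INF_greatest) simp
  also have "\<dots> \<le> Sup {INF j\<in>J. final A (dvba_run A w j) | J. infinite J}"
    using inf by (blast intro: Sup_upper)
  finally show "final A q \<le> Sup {INF j\<in>J. final A (dvba_run A w j) | J. infinite J}" .
qed

lemma dvba_run_in_locations:
  assumes "is_dvba A" "w \<in> omega_words (alphabet A)"
  shows "dvba_run A w j \<in> locations A"
  using assms by (induction j) (auto simp: is_dvba_def omega_words_def)

lemma pers_nonfinal_form_run:
  assumes "is_dvba A" "w \<in> omega_words (alphabet A)" "set qs = locations A"
  shows "pers (nonfinal_form A qs) (\<lambda>j. {dvba_run A w (Suc j)}) = - omega_lang A w"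
proof -
  have fin: "finite (range (dvba_run A w))"
    using assms(1) dvba_run_in_locations[OF assms(1,2)]
    by (auto simp: is_dvba_def intro: finite_subset)
  have "range (suffix 1 (dvba_run A w)) \<subseteq> range (dvba_run A w)"
    by (auto simp del: dvba_run.simps)
  then have fin': "finite (range (suffix 1 (dvba_run A w)))"
    using fin by (rule finite_subset)
  have "pers (nonfinal_form A qs) (\<lambda>j. {dvba_run A w (Suc j)}) =
      (SUP i. INF j\<in>{i..}. - final A (suffix 1 (dvba_run A w) j))"
    using dvba_run_in_locations[OF assms(1,2)] assms(3)
    by (simp add: pers_def form_eval_nonfinal_form del: dvba_run.simps)
  \<comment> \<open>Dropping the start location does not change which locations recur, so the shift
    by one disappears in the limit.\<close>
  also have "\<dots> = (INF q\<in>limit (dvba_run A w). - final A q)"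
    using SUP_INF_eq_INF_limit[OF fin', of "\<lambda>q. - final A q"] by simp
  also have "\<dots> = - omega_lang A w"
    by (simp add: omega_lang_eq_SUP_limit[OF fin] uminus_SUP)
  finally show ?thesis .
qed

section \<open>Runs of the product\<close>

text \<open>A join lies below a bound iff all its members do, and words labelling no run impose
  nothing because their join is empty.\<close>

lemma satisfies_iff_runs:
  assumes "is_mvts TS"
  shows "satisfies TS P \<longleftrightarrow> (\<forall>\<rho>\<in>runs TS. run_value TS \<rho> \<le> P (label TS \<circ> fst \<rho>))"
proof -
  have "label TS \<circ> fst \<rho> \<in> omega_words (Pow (atoms TS))" if "\<rho> \<in> runs TS" for \<rho>
    using that assms by (auto simp: runs_def omega_words_def is_mvts_def)
  then show ?thesis
    unfolding satisfies_def traces_def Sup_le_iff by blast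
qed

text \<open>
  In the product the initial state has already read the label of \<open>s\<^sub>0\<close>, so its location at
  index \<open>i\<close> is the one of the automaton at index \<open>i + 1\<close>.
\<close>

lemma run_value_product_run:
  "run_value (product TS A) (\<lambda>i. (s i, dvba_run A (label TS \<circ> s) (Suc i)), \<alpha>) =
    run_value TS (s, \<alpha>)"
  by (simp add: run_value_def product_def)

text \<open>A value other than \<open>bot\<close> forces the conditions in \<open>init\<close> and
  in every \<open>trans\<close> of the product to hold, and these determine the locations
  inductively.\<close>

lemma product_run_follows_automaton:
  assumes "run_value (product TS A) (sq, \<alpha>) \<noteq> bot"
  shows "sq = (\<lambda>i. ((fst \<circ> sq) i, dvba_run A (label TS \<circ> (fst \<circ> sq)) (Suc i)))"
proof -
  have init: "init (product TS A) (sq 0) \<noteq> bot"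
    using assms by (auto simp: run_value_def)
  have trans: "trans (product TS A) (sq i) (\<alpha> i) (sq (Suc i)) \<noteq> bot" for i
  proof
    assume "trans (product TS A) (sq i) (\<alpha> i) (sq (Suc i)) = bot"
    then have "(INF i. trans (product TS A) (sq i) (\<alpha> i) (sq (Suc i))) = bot"
      using INF_lower[OF UNIV_I, of "\<lambda>i. trans (product TS A) (sq i) (\<alpha> i) (sq (Suc i))" i]
      by (simp add: bot_unique)
    with assms show False
      by (simp add: run_value_def)
  qed
  have "snd (sq i) = dvba_run A (label TS \<circ> (fst \<circ> sq)) (Suc i)" for i
  proof (induction i)
    case 0
    show ?case
      using init by (auto simp: product_def split: prod.splits if_splits)
  next
    case (Suc i)
    have "snd (sq (Suc i)) = step A (snd (sq i)) (label TS (fst (sq (Suc i))))"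
      using trans[of i] by (auto simp: product_def split: prod.splits if_splits)
    with Suc show ?case
      by simp
  qed
  then show ?thesis
    by (intro ext prod_eqI) simp_all
qed

theorem theorem3:
  fixes TS :: "('s, 'a, 'p, 'l::residuated_de_morgan) mvts"
    and P :: "'p set word \<Rightarrow> 'l"
    and A :: "('q, 'p set, 'l) dvba"
    and qs :: "'q list"
  assumes "is_mvts TS" and "no_terminal_states TS"
    and "is_dvba A" and "alphabet A = Pow (atoms TS)"
    and "\<forall>w \<in> omega_words (Pow (atoms TS)). omega_lang A w = (- P) w"
    and "distinct qs" and "set qs = locations A"
  shows "satisfies TS P \<longleftrightarrow> satisfies (product TS A) (pers (nonfinal_form A qs))"
proof -
  let ?\<phi> = "nonfinal_form A qs"
  let ?lift = "\<lambda>s i. (s i, dvba_run A (label TS \<circ> s) (Suc i))"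
  have word: "label TS \<circ> s \<in> omega_words (alphabet A)" if "s \<in> omega_words (states TS)" for s
    using that assms(1,4) by (auto simp: omega_words_def is_mvts_def)
  \<comment> \<open>The automaton accepts the complement of \<open>P\<close>, so complementing once
    more recovers \<open>P\<close> along lifted runs.\<close>
  have pers: "pers ?\<phi> (label (product TS A) \<circ> ?lift s) = P (label TS \<circ> s)"
    if "s \<in> omega_words (states TS)" for s
  proof -
    have "label (product TS A) \<circ> ?lift s = (\<lambda>j. {dvba_run A (label TS \<circ> s) (Suc j)})"
      by (auto simp: product_def)
    then have "pers ?\<phi> (label (product TS A) \<circ> ?lift s) = - omega_lang A (label TS \<circ> s)"
      using pers_nonfinal_form_run[OF assms(3) word[OF that] assms(7)] by simp
    also have "\<dots> = P (label TS \<circ> s)"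
      using word[OF that] assms(4,5) by (simp add: uminus_uminus)
    finally show ?thesis .
  qed
  show ?thesis
    unfolding satisfies_iff_runs[OF assms(1)]
      satisfies_iff_runs[OF is_mvts_product[OF assms(1,3)]]
  proof (intro iffI ballI)
    fix \<rho> assume TS: "\<forall>\<rho>\<in>runs TS. run_value TS \<rho> \<le> P (label TS \<circ> fst \<rho>)"
      and \<rho>: "\<rho> \<in> runs (product TS A)"
    obtain sq \<alpha> where sq: "\<rho> = (sq, \<alpha>)"
      by (cases \<rho>)
    show "run_value (product TS A) \<rho> \<le> pers ?\<phi> (label (product TS A) \<circ> fst \<rho>)"
    \<comment> \<open>Only runs following the automaton need the hypothesis on \<open>TS\<close>; a
      run of value \<open>bot\<close> satisfies any bound.\<close>
    proof (cases "run_value (product TS A) \<rho> = bot")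
      case False
      define s where "s = fst \<circ> sq"
      have lift: "sq = ?lift s"
        unfolding s_def
        by (rule product_run_follows_automaton[where \<alpha> = \<alpha>])
            (use False in \<open>simp only: sq not_False_eq_True\<close>)
      have s: "s \<in> omega_words (states TS)" and \<alpha>: "\<alpha> \<in> omega_words (actions TS)"
        using \<rho> by (auto simp: sq s_def runs_def omega_words_def product_def mem_Times_iff)
      have "run_value TS (s, \<alpha>) \<le> P (label TS \<circ> s)"
        using TS s \<alpha> by (auto simp: runs_def)
      then show ?thesis
        using pers[OF s] run_value_product_run[of TS A s \<alpha>] lift
        unfolding sq fst_conv by metis
    qed simp
  next
    fix \<rho> assume prod: "\<forall>\<rho>\<in>runs (product TS A).
        run_value (product TS A) \<rho> \<le> pers ?\<phi> (label (product TS A) \<circ> fst \<rho>)"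
      and \<rho>: "\<rho> \<in> runs TS"
    obtain s \<alpha> where s\<alpha>: "\<rho> = (s, \<alpha>)"
      by (cases \<rho>)
    have s: "s \<in> omega_words (states TS)" and \<alpha>: "\<alpha> \<in> omega_words (actions TS)"
      using \<rho> by (auto simp: s\<alpha> runs_def)
    \<comment> \<open>The hypothesis on the product is instantiated at the lift, whose value and
      \<open>pers\<close> bound are those of the original run.\<close>
    have "(?lift s, \<alpha>) \<in> runs (product TS A)"
      using s \<alpha> dvba_run_in_locations[OF assms(3) word[OF s]]
      by (simp add: runs_def omega_words_def product_def del: dvba_run.simps)
    then have "run_value (product TS A) (?lift s, \<alpha>) \<le>
        pers ?\<phi> (label (product TS A) \<circ> ?lift s)"
      using prod by fastforce
    then show "run_value TS \<rho> \<le> P (label TS \<circ> fst \<rho>)"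
      unfolding s\<alpha> fst_conv pers[OF s] run_value_product_run .
  qed
qed

end
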